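(* Let $\lambda$ and $\kappa$ be infinite cardinals, let $(\mu_\gamma)_{\gamma\in\kappa}$ be a sequence of infinite regular cardinals, and suppose that each $\mu_\gamma$ is endowed either with the order topology or with the initial interval topology. Then the product $\prod_{\gamma\in\kappa}\mu_\gamma$ is $[\lambda,\lambda]$-compact if and only if $(\lambda,\lambda)\not\Rightarrow(\mu_\gamma)_{\gamma\in\kappa}$.
   Context: The initial interval topology on a cardinal $\mu$ is the topology whose open sets are the intervals $[0,\alpha)$ with $\alpha\leq\mu$. Products of topological spaces carry the Tychonoff product topology. A topological space is $[\lambda,\lambda]$-compact if every open cover by at most $\lambda$ sets has a subcover by less than $\lambda$ sets. $[\lambda]^{<\lambda}$ is the set of all subsets of $\lambda$ of cardinality $<\lambda$. An ultrafilter $D$ over $[\lambda]^{<\lambda}$ covers $\lambda$ if $\{s\in[\lambda]^{<\lambda}\mid\alpha\in s\}\in D$ for every $\alpha\in\lambda$. If $D$ is an ultrafilter over a set $I$ and $f\colon I\to J$ is a function, $f(D)$ is the ultrafilter over $J$ defined by: $Y\in f(D)$ if and only if $f^{-1}(Y)\in D$. An ultrafilter over an infinite cardinal $\mu$ is uniform if all its members have cardinality $\mu$. The notation $(\lambda,\lambda)\not\Rightarrow(\mu_\gamma)_{\gamma\in\kappa}$ means: for every sequence of functions $(f_\gamma)_{\gamma\in\kappa}$ with $f_\gamma\colon[\lambda]^{<\lambda}\to\mu_\gamma$ for each $\gamma\in\kappa$, there is some ultrafilter $D$ over $[\lambda]^{<\lambda}$ covering $\lambda$ such that for no $\gamma\in\kappa$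 is $f_\gamma(D)$ uniform over $\mu_\gamma$. *)

theory Defs
  imports "HOL-Analysis.Function_Topology"
begin

unbundle cardinal_syntax

text \<open>
  An infinite cardinal is a relation \<open>r\<close> with \<open>Cinfinite r\<close>: an infinite well-order that is minimal
  among the well-orders of its field. The ordinals below it are the elements of \<open>Field r\<close>, and
  \<open>underS r a\<close> is the interval \<open>[0,a)\<close>.
\<close>

definition wo_order_topology :: "'a rel \<Rightarrow> 'a topology" where
  "wo_order_topology r = topology_generated_by
     ({Field r} \<union> {underS r a | a. a \<in> Field r} \<union> {aboveS r a | a. a \<in> Field r})"

text \<open>The first disjunct is the interval \<open>[0,\<alpha>)\<close> where \<open>\<alpha>\<close> is the whole cardinal.\<close>

definition initial_interval_topology :: "'a rel \<Rightarrow> 'a topology" where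
  "initial_interval_topology r =
     topology (\<lambda>U. U = Field r \<or> (\<exists>a\<in>Field r. U = underS r a))"

lemma topspace_wo_order_topology: "topspace (wo_order_topology r) = Field r"
proof -
  have "underS r a \<subseteq> Field r" "aboveS r a \<subseteq> Field r" for a
    by (auto simp: underS_def aboveS_def Field_def)
  then show ?thesis
    unfolding wo_order_topology_def topology_generated_by_topspace by blast
qed

lemma openin_initial_interval_topology:
  assumes "Cinfinite r"
  shows "openin (initial_interval_topology r) U \<longleftrightarrow>
           U = Field r \<or> (\<exists>a\<in>Field r. U = underS r a)"
proof -
  have wo: "Well_order r"
    using assms card_order_on_well_order_on[of "Field r" r] by simp
  then have wr: "wo_rel r"
    by (simp add: wo_rel_def)
  have eq: "(\<lambda>U. U = Field r \<or> (\<exists>a\<in>Field r. U = underS r a)) = wo_rel.ofilter r"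
    by (rule ext) (simp add: wo_rel.ofilter_underS_Field[OF wr] disj_commute)
  have top: "istopology (wo_rel.ofilter r)"
    unfolding istopology_def
  proof (intro conjI allI impI)
    fix S T
    assume "wo_rel.ofilter r S" "wo_rel.ofilter r T"
    then show "wo_rel.ofilter r (S \<inter> T)"
      by (auto simp: wo_rel.ofilter_def[OF wr])
  next
    fix \<K>
    assume "\<forall>K\<in>\<K>. wo_rel.ofilter r K"
    then show "wo_rel.ofilter r (\<Union>\<K>)"
      unfolding wo_rel.ofilter_def[OF wr] by (meson UnionE Union_least Union_upper order_trans)
  qed
  show ?thesis
    unfolding initial_interval_topology_def eq topology_inverse'[OF top]
    by (rule fun_cong[OF eq, symmetric])
qed

lemma topspace_initial_interval_topology:
  assumes "Cinfinite r"
  shows "topspace (initial_interval_topology r) = Field r"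
proof -
  have "underS r a \<subseteq> Field r" for a
    by (auto simp: underS_def Field_def)
  then show ?thesis
    unfolding topspace_def openin_initial_interval_topology[OF assms] by blast
qed

definition cover_compact :: "'l rel \<Rightarrow> 'a topology \<Rightarrow> bool" where
  "cover_compact lam X \<longleftrightarrow>
     (\<forall>\<U>. (\<forall>U\<in>\<U>. openin X U) \<and> topspace X \<subseteq> \<Union>\<U> \<and> |\<U>| \<le>o lam \<longrightarrow>
        (\<exists>\<V>. \<V> \<subseteq> \<U> \<and> topspace X \<subseteq> \<Union>\<V> \<and> |\<V>| <o lam))"

definition small_subsets :: "'l rel \<Rightarrow> 'l set set" where
  "small_subsets lam = {s. s \<subseteq> Field lam \<and> |s| <o lam}"

definition ultrafilter_over :: "'i set \<Rightarrow> 'i set set \<Rightarrow> bool" where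
  "ultrafilter_over I D \<longleftrightarrow>
     D \<subseteq> Pow I \<and> I \<in> D \<and> {} \<notin> D \<and>
     (\<forall>A\<in>D. \<forall>B\<in>D. A \<inter> B \<in> D) \<and>
     (\<forall>A\<in>D. \<forall>B. A \<subseteq> B \<and> B \<subseteq> I \<longrightarrow> B \<in> D) \<and>
     (\<forall>A. A \<subseteq> I \<longrightarrow> A \<in> D \<or> I - A \<in> D)"

definition covers_cardinal :: "'l rel \<Rightarrow> 'l set set set \<Rightarrow> bool" where
  "covers_cardinal lam D \<longleftrightarrow> (\<forall>a\<in>Field lam. {s \<in> small_subsets lam. a \<in> s} \<in> D)"

definition image_ultrafilter :: "'i set \<Rightarrow> 'j set \<Rightarrow> ('i \<Rightarrow> 'j) \<Rightarrow> 'i set set \<Rightarrow> 'j set set" where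
  "image_ultrafilter I J f D = {Y. Y \<subseteq> J \<and> f -` Y \<inter> I \<in> D}"

definition uniform_over :: "'m rel \<Rightarrow> 'm set set \<Rightarrow> bool" where
  "uniform_over mu E \<longleftrightarrow> (\<forall>Y\<in>E. |Y| =o mu)"

text \<open>The relation \<open>(\<lambda>,\<lambda>) \<not>\<Rightarrow> (\<mu>\<^sub>\<gamma>)\<^sub>\<gamma>\<^sub>\<in>\<^sub>\<kappa>\<close>.\<close>

definition not_arrow :: "'l rel \<Rightarrow> 'k rel \<Rightarrow> ('k \<Rightarrow> 'm rel) \<Rightarrow> bool" where
  "not_arrow lam kap mu \<longleftrightarrow>
     (\<forall>f :: 'k \<Rightarrow> 'l set \<Rightarrow> 'm.
        (\<forall>\<gamma>\<in>Field kap. f \<gamma> \<in> small_subsets lam \<rightarrow> Field (mu \<gamma>)) \<longrightarrow>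
        (\<exists>D. ultrafilter_over (small_subsets lam) D \<and> covers_cardinal lam D \<and>
             \<not> (\<exists>\<gamma>\<in>Field kap. uniform_over (mu \<gamma>)
                   (image_ultrafilter (small_subsets lam) (Field (mu \<gamma>)) (f \<gamma>) D))))"

end

theory Submission
  imports Defs
begin

text \<open>
  Compactness of the kind considered here can be tested by convergence. A space is
  \<open>[\<lambda>,\<lambda>]\<close>-compact iff every family of points indexed by \<open>[\<lambda>]\<^sup><\<^sup>\<lambda>\<close> converges along
  some ultrafilter that covers \<open>\<lambda>\<close> (\<open>cover_compact_imp_limit\<close> and \<open>limits_imp_cover_compact\<close>).
  A family of points of the product is the same thing as a sequence of functions
  \<open>f\<^sub>\<gamma>\<close> from \<open>[\<lambda>]\<^sup><\<^sup>\<lambda>\<close> to \<open>\<mu>\<^sub>\<gamma>\<close>, and convergence in the product is convergence in each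
  coordinate along the same ultrafilter \<open>D\<close>. Finally, in an infinite regular cardinal \<open>\<mu>\<close>
  with either of the two topologies, \<open>f\<close> converges along \<open>D\<close> iff \<open>f(D)\<close> is not uniform
  (\<open>limit_iff_not_uniform\<close>): failure of uniformity means, by regularity, that some bounded interval
  belongs to \<open>f(D)\<close>, and the least endpoint of such an interval is a limit. Thus both sides of the
  theorem say that every sequence \<open>(f\<^sub>\<gamma>)\<close> admits an ultrafilter covering \<open>\<lambda>\<close> along which
  all the \<open>f\<^sub>\<gamma>\<close> converge.
\<close>

section \<open>Ultrafilters on a set\<close>

lemma ultrafilter_over_Int:
  assumes "ultrafilter_over I D" "A \<in> D" "B \<in> D"
  shows "A \<inter> B \<in> D"
  using assms unfolding ultrafilter_over_def by blast

lemma ultrafilter_over_upward: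
  assumes "ultrafilter_over I D" "A \<in> D" "A \<subseteq> B" "B \<subseteq> I"
  shows "B \<in> D"
  using assms unfolding ultrafilter_over_def by blast

lemma ultrafilter_over_Diff:
  assumes "ultrafilter_over I D" "A \<subseteq> I" "A \<notin> D"
  shows "I - A \<in> D"
  using assms unfolding ultrafilter_over_def by blast

lemma ultrafilter_over_nonempty:
  assumes "ultrafilter_over I D" "A \<in> D"
  shows "A \<noteq> {}"
  using assms unfolding ultrafilter_over_def by blast

text \<open>
  A maximal family with the finite intersection property contains every set that meets all
  finite intersections of its members. All the ultrafilter axioms follow from this.
\<close>

lemma ultrafilter_over_extending:
  assumes sub: "B \<subseteq> Pow I"
    and fip: "\<And>F. finite F \<Longrightarrow> F \<subseteq> B \<Longrightarrow> I \<inter> \<Inter>F \<noteq> {}"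
  obtains D where "ultrafilter_over I D" "B \<subseteq> D"
proof -
  define \<A> where
    "\<A> = {D. B \<subseteq> D \<and> D \<subseteq> Pow I \<and> (\<forall>F. finite F \<and> F \<subseteq> D \<longrightarrow> I \<inter> \<Inter>F \<noteq> {})}"
  have "\<exists>D\<in>\<A>. \<forall>E\<in>\<A>. D \<subseteq> E \<longrightarrow> E = D"
  proof (rule subset_Zorn_nonempty)
    have "B \<in> \<A>"
      using sub fip by (simp add: \<A>_def)
    then show "\<A> \<noteq> {}"
      by auto
  next
    fix \<C> assume ne: "\<C> \<noteq> {}" and chain: "subset.chain \<A> \<C>"
    have mem: "\<C> \<subseteq> \<A>"
      using chain by (simp add: subset.chain_def)
    have "I \<inter> \<Inter>F \<noteq> {}" if F: "finite F" "F \<subseteq> \<Union>\<C>" for F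
    proof -
      obtain E where E: "E \<in> \<C>" "F \<subseteq> E"
        using finite_subset_Union_chain[OF F ne chain] .
      then have "E \<in> \<A>"
        using mem by auto
      then show ?thesis
        using F(1) E(2) by (simp add: \<A>_def)
    qed
    moreover have "B \<subseteq> E \<and> E \<subseteq> Pow I" if "E \<in> \<C>" for E
      using subsetD[OF mem that] by (simp add: \<A>_def)
    then have "B \<subseteq> \<Union>\<C>" "\<Union>\<C> \<subseteq> Pow I"
      using ne by blast+
    ultimately show "\<Union>\<C> \<in> \<A>"
      by (simp add: \<A>_def)
  qed
  then obtain D where D: "D \<in> \<A>" and max: "\<And>E. E \<in> \<A> \<Longrightarrow> D \<subseteq> E \<Longrightarrow> E = D"
    by blast
  have BD: "B \<subseteq> D" and DI: "D \<subseteq> Pow I"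
    and DF: "\<And>F. finite F \<Longrightarrow> F \<subseteq> D \<Longrightarrow> I \<inter> \<Inter>F \<noteq> {}"
    using D by (simp_all add: \<A>_def)
  have in_D: "A \<in> D"
    if A: "A \<subseteq> I" and meets: "\<And>F. finite F \<Longrightarrow> F \<subseteq> D \<Longrightarrow> A \<inter> \<Inter>F \<noteq> {}" for A
  proof -
    have "I \<inter> \<Inter>F \<noteq> {}" if F: "finite F" "F \<subseteq> insert A D" for F
    proof -
      have "A \<inter> \<Inter>(F - {A}) \<noteq> {}"
        using F by (intro meets) auto
      then show ?thesis
        using A by auto
    qed
    then have "insert A D \<in> \<A>"
      using A BD DI unfolding \<A>_def by (simp add: subset_insertI2)
    then have "insert A D = D"
      by (rule max) blast
    then show ?thesis
      by blast
  qed
  have "ultrafilter_over I D"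
    unfolding ultrafilter_over_def
  proof (intro conjI ballI allI impI)
    show "D \<subseteq> Pow I" by (rule DI)
    show "I \<in> D" using DF by (intro in_D) auto
    show "{} \<notin> D" using DF[of "{{}}"] by auto
  next
    fix A A' assume A: "A \<in> D" "A' \<in> D"
    show "A \<inter> A' \<in> D"
    proof (rule in_D)
      show "A \<inter> A' \<subseteq> I" using A DI by blast
      fix F assume "finite F" "F \<subseteq> D"
      then show "A \<inter> A' \<inter> \<Inter>F \<noteq> {}"
        using DF[of "insert A (insert A' F)"] A by auto
    qed
  next
    fix A C assume A: "A \<in> D" and C: "A \<subseteq> C \<and> C \<subseteq> I"
    show "C \<in> D"
    proof (rule in_D)
      show "C \<subseteq> I" using C by blast
      fix F assume "finite F" "F \<subseteq> D"
      then show "C \<inter> \<Inter>F \<noteq> {}"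
        using DF[of "insert A F"] A C by auto
    qed
  next
    fix A assume A: "A \<subseteq> I"
    show "A \<in> D \<or> I - A \<in> D"
    proof (rule ccontr)
      assume no: "\<not> (A \<in> D \<or> I - A \<in> D)"
      obtain F where F: "finite F" "F \<subseteq> D" "A \<inter> \<Inter>F = {}"
        using in_D[of A] A no by auto
      obtain G where G: "finite G" "G \<subseteq> D" "(I - A) \<inter> \<Inter>G = {}"
        using in_D[of "I - A"] no by auto
      have "I \<inter> \<Inter>(F \<union> G) \<noteq> {}"
        using F G by (intro DF) auto
      then show False
        using F(3) G(3) by (auto simp: Inter_Un_distrib)
    qed
  qed
  then show thesis
    using that BD by blast
qed

text \<open>
  Turning \<open>D\<close> into a filter on the whole type makes \<open>D\<close>-convergence an instance of
  \<^const>\<open>limitin\<close>.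
\<close>

definition filter_of :: "'i set \<Rightarrow> 'i set set \<Rightarrow> 'i filter" where
  "filter_of I D = Abs_filter (\<lambda>P. {i \<in> I. P i} \<in> D)"

lemma eventually_filter_of:
  assumes D: "ultrafilter_over I D"
  shows "eventually P (filter_of I D) \<longleftrightarrow> {i \<in> I. P i} \<in> D"
  unfolding filter_of_def
proof (rule eventually_Abs_filter, rule is_filter.intro)
  show "{i \<in> I. True} \<in> D"
    using D by (simp add: ultrafilter_over_def)
next
  fix P Q assume "{i \<in> I. P i} \<in> D" "{i \<in> I. Q i} \<in> D"
  then have "{i \<in> I. P i} \<inter> {i \<in> I. Q i} \<in> D"
    by (rule ultrafilter_over_Int[OF D])
  then show "{i \<in> I. P i \<and> Q i} \<in> D"
    by (rule ultrafilter_over_upward[OF D]) auto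
next
  fix P Q assume PQ: "\<forall>i. P i \<longrightarrow> Q i" and P: "{i \<in> I. P i} \<in> D"
  show "{i \<in> I. Q i} \<in> D"
    by (rule ultrafilter_over_upward[OF D P]) (use PQ in auto)
qed

section \<open>Cardinalities of families of finite sets\<close>

text \<open>
  The sets with at most \<open>n + 1\<close> elements arise from those with at most \<open>n\<close> by inserting one
  element, which does not increase the cardinality beyond \<open>|A|\<close>; then take the union over \<open>n\<close>.
\<close>

lemma card_of_Fpow_ordLeq:
  assumes inf: "infinite A"
  shows "|Fpow A| \<le>o |A|"
proof -
  have bounded: "|{F \<in> Fpow A. card F \<le> n}| \<le>o |A|" for n
  proof (induction n)
    case 0
    have "{F \<in> Fpow A. card F \<le> 0} = {{}}"
      by (auto simp: Fpow_def)
    moreover have "|{{}}| \<le>o |A|"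
      using inf by (intro card_of_singl_ordLeq) auto
    ultimately show ?case
      by metis
  next
    case (Suc n)
    let ?P = "A \<times> {F \<in> Fpow A. card F \<le> n}"
    have "F \<in> insert {} ((\<lambda>(a, F). insert a F) ` ?P)"
      if F: "F \<in> Fpow A" "card F \<le> Suc n" for F
    proof (cases "F = {}")
      case False
      then obtain a where "a \<in> F" by blast
      then have "F = insert a (F - {a})" "(a, F - {a}) \<in> ?P"
        using F by (auto simp: Fpow_def card_Diff_singleton)
      then show ?thesis
        by (intro insertI2 image_eqI[where x = "(a, F - {a})"]) auto
    qed simp
    then have "{F \<in> Fpow A. card F \<le> Suc n} \<subseteq> {{}} \<union> (\<lambda>(a, F). insert a F) ` ?P"
      by auto
    then have "|{F \<in> Fpow A. card F \<le> Suc n}| \<le>o |{{}} \<union> (\<lambda>(a, F). insert a F) ` ?P|"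
      by (rule card_of_mono1)
    also have "|{{}} \<union> (\<lambda>(a, F). insert a F) ` ?P| \<le>o |A|"
    proof (rule card_of_Un_ordLeq_infinite_Field)
      show "|{{}}| \<le>o |A|"
        using inf by (intro card_of_singl_ordLeq) auto
      have "|?P| \<le>o |A|"
        using Suc by (intro card_of_Sigma_ordLeq_infinite[OF inf] ballI)
          (simp_all add: ordIso_imp_ordLeq[OF card_of_refl])
      then show "|(\<lambda>(a, F). insert a F) ` ?P| \<le>o |A|"
        by (rule ordLeq_transitive[OF card_of_image])
    qed (use inf in \<open>simp_all add: Field_card_of card_of_card_order_on\<close>)
    finally show ?case .
  qed
  have "Fpow A = (\<Union>n\<in>(UNIV::nat set). {F \<in> Fpow A. card F \<le> n})"
    by auto
  also have "|\<dots>| \<le>o |A|"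
    using inf bounded by (intro card_of_UNION_ordLeq_infinite) (auto simp: infinite_iff_card_of_nat)
  finally show ?thesis .
qed

text \<open>
  For countable \<open>r\<close> this says that a finite union of finite sets is finite, so the case of a
  finite index set needs its own argument.
\<close>

lemma card_of_Union_finite_sets_ordLess:
  assumes r: "Cinfinite r" and I: "|I| <o r" and fin: "\<And>i. i \<in> I \<Longrightarrow> finite (A i)"
  shows "|\<Union>i\<in>I. A i| <o r"
proof (cases "finite I")
  case True
  then have "finite (\<Union>i\<in>I. A i)"
    using fin by blast
  then show ?thesis
    using r finite_ordLess_infinite[OF card_of_Well_order[of "\<Union>i\<in>I. A i"], of r]
      card_order_on_well_order_on
    by (metis Field_card_of cinfinite_def)
next
  case False
  then have "|A i| \<le>o |I|" if "i \<in> I" for i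
    using that fin
    by (intro ordLess_imp_ordLeq finite_ordLess_infinite card_of_Well_order)
       (simp_all add: Field_card_of)
  then have "|\<Union>i\<in>I. A i| \<le>o |I|"
    using False by (intro card_of_UNION_ordLeq_infinite ballI) (simp_all add: ordIso_imp_ordLeq[OF card_of_refl])
  then show ?thesis
    using I ordLeq_ordLess_trans by blast
qed

section \<open>Compactness in terms of ultrafilter convergence\<close>

text \<open>
  The closures of the tails \<open>{x s | F \<subseteq> s}\<close>, for \<open>F\<close> a finite subset of \<open>\<lambda>\<close>, form a
  family of at most \<open>\<lambda>\<close> closed sets. Fewer than \<open>\<lambda>\<close> of them have a common point, namely
  \<open>x s\<close> where \<open>s\<close> is the union of the corresponding sets \<open>F\<close>, so by compactness all of them have
  a common point \<open>p\<close>. Hence the sets of those \<open>s\<close> that include a given \<open>F\<close> and have \<open>x s\<close> in a given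
  neighbourhood of \<open>p\<close> generate a proper filter. The tails are indexed by finite sets and not by
  single elements because this family has to be closed under finite intersections.
\<close>

lemma cover_compact_imp_limit:
  fixes lam :: "'l rel" and x :: "'l set \<Rightarrow> 'a"
  assumes lam: "Cinfinite lam" and comp: "cover_compact lam T"
    and x: "x \<in> small_subsets lam \<rightarrow> topspace T"
  obtains D p where "ultrafilter_over (small_subsets lam) D" "covers_cardinal lam D"
    "limitin T x p (filter_of (small_subsets lam) D)"
proof -
  let ?S = "small_subsets lam"
  define cl where "cl F = T closure_of (x ` {s \<in> ?S. F \<subseteq> s})" for F
  let ?\<U> = "(\<lambda>F. topspace T - cl F) ` Fpow (Field lam)"
  have "\<exists>p \<in> topspace T. \<forall>F \<in> Fpow (Field lam). p \<in> cl F"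
  proof (rule ccontr)
    assume "\<not> ?thesis"
    then have "topspace T \<subseteq> \<Union>?\<U>"
      by auto
    moreover have "\<forall>U\<in>?\<U>. openin T U"
      by (auto simp: cl_def)
    moreover have "|?\<U>| \<le>o lam"
    proof -
      have "|Fpow (Field lam)| \<le>o |Field lam|"
        using lam by (intro card_of_Fpow_ordLeq) (simp add: cinfinite_def)
      moreover have "|Field lam| =o lam"
        using lam by (simp add: card_of_Field_ordIso)
      ultimately show ?thesis
        using card_of_image ordLeq_ordIso_trans ordLeq_transitive by metis
    qed
    ultimately obtain \<V> where \<V>: "\<V> \<subseteq> ?\<U>" "topspace T \<subseteq> \<Union>\<V>" "|\<V>| <o lam"
      using comp unfolding cover_compact_def by metis
    then have "\<forall>V\<in>\<V>. \<exists>F \<in> Fpow (Field lam). V = topspace T - cl F"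
      by blast
    then obtain F where F: "\<And>V. V \<in> \<V> \<Longrightarrow> F V \<in> Fpow (Field lam)"
      "\<And>V. V \<in> \<V> \<Longrightarrow> V = topspace T - cl (F V)"
      by metis
    \<comment> \<open>The point \<open>x s\<close> for this \<open>s\<close> is in none of the members of the subcover.\<close>
    define s where "s = (\<Union>V\<in>\<V>. F V)"
    have "|s| <o lam"
      unfolding s_def using F(1) lam \<V>(3)
      by (intro card_of_Union_finite_sets_ordLess) (auto simp: Fpow_def)
    moreover have "s \<subseteq> Field lam"
      using F(1) unfolding s_def Fpow_def by blast
    ultimately have s: "s \<in> ?S"
      by (simp add: small_subsets_def)
    then obtain V where V: "V \<in> \<V>" "x s \<in> V"
      using x \<V>(2) by blast
    have "x ` {s \<in> ?S. F V \<subseteq> s} \<subseteq> topspace T"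
      using x by blast
    then have "x ` {s \<in> ?S. F V \<subseteq> s} \<subseteq> cl (F V)"
      unfolding cl_def by (rule closure_of_subset)
    moreover have "F V \<subseteq> s"
      using V(1) by (auto simp: s_def)
    ultimately have "x s \<in> cl (F V)"
      using s by blast
    then show False
      using V F(2) by blast
  qed
  then obtain p where p: "p \<in> topspace T" "\<And>F. F \<in> Fpow (Field lam) \<Longrightarrow> p \<in> cl F"
    by blast
  define B where
    "B = {{s \<in> ?S. F \<subseteq> s \<and> x s \<in> U} | F U. F \<in> Fpow (Field lam) \<and> openin T U \<and> p \<in> U}"
  have BI: "{s \<in> ?S. F \<subseteq> s \<and> x s \<in> U} \<in> B"
    if "F \<in> Fpow (Field lam)" "openin T U" "p \<in> U" for F U
    using that unfolding B_def by blast
  have B_nonempty: "A \<noteq> {}" if A_in: "A \<in> B" for A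
  proof -
    obtain F U where FU: "F \<in> Fpow (Field lam)" "openin T U" "p \<in> U"
      and A: "A = {s \<in> ?S. F \<subseteq> s \<and> x s \<in> U}"
      using A_in unfolding B_def by blast
    have "\<exists>y. y \<in> x ` {s \<in> ?S. F \<subseteq> s} \<and> y \<in> U"
      using p(2)[OF FU(1)] FU(2,3) unfolding cl_def in_closure_of by blast
    then show ?thesis
      unfolding A by blast
  qed
  have B_Int: "A \<inter> A' \<in> B" if AA': "A \<in> B" "A' \<in> B" for A A'
  proof -
    obtain F U F' U' where FU: "F \<in> Fpow (Field lam)" "openin T U" "p \<in> U"
      and FU': "F' \<in> Fpow (Field lam)" "openin T U'" "p \<in> U'"
      and A: "A = {s \<in> ?S. F \<subseteq> s \<and> x s \<in> U}" "A' = {s \<in> ?S. F' \<subseteq> s \<and> x s \<in> U'}"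
      using AA' unfolding B_def by blast
    have "A \<inter> A' = {s \<in> ?S. F \<union> F' \<subseteq> s \<and> x s \<in> U \<inter> U'}"
      unfolding A by blast
    also have "\<dots> \<in> B"
      using FU FU' by (intro BI) (auto simp: Fpow_def)
    finally show ?thesis .
  qed
  have S_in_B: "?S \<in> B"
    using BI[OF empty_in_Fpow openin_topspace p(1)] x
    by (simp add: Pi_iff cong: conj_cong)
  have "?S \<inter> \<Inter>G \<in> B" if "finite G" "G \<subseteq> B" for G
    using that
  proof (induction G)
    case (insert A G)
    then have "A \<inter> (?S \<inter> \<Inter>G) \<in> B"
      by (intro B_Int[of A "?S \<inter> \<Inter>G"]) simp_all
    moreover have "A \<inter> (?S \<inter> \<Inter>G) = ?S \<inter> \<Inter>(insert A G)"
      by auto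
    ultimately show ?case
      by argo
  qed (use S_in_B in simp)
  then obtain D where D: "ultrafilter_over ?S D" and BD: "B \<subseteq> D"
    using B_nonempty by (elim ultrafilter_over_extending[rotated -1]) (auto simp: B_def)
  show thesis
  proof (rule that[OF D])
    show "covers_cardinal lam D"
      unfolding covers_cardinal_def
    proof
      fix a assume "a \<in> Field lam"
      then have "{s \<in> ?S. {a} \<subseteq> s \<and> x s \<in> topspace T} \<in> D"
        using BI[of "{a}"] p(1) BD by (auto simp: Fpow_def)
      then show "{s \<in> ?S. a \<in> s} \<in> D"
        by (rule ultrafilter_over_upward[OF D]) auto
    qed
    have "{s \<in> ?S. x s \<in> U} \<in> D" if "openin T U" "p \<in> U" for U
      using BI[OF empty_in_Fpow that] BD by auto
    then show "limitin T x p (filter_of ?S D)"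
      unfolding limitin_def using p(1) eventually_filter_of[OF D] by blast
  qed
qed

text \<open>
  Index a bad cover by elements of \<open>\<lambda>\<close>, and for each \<open>s\<close> pick a point \<open>x s\<close> outside all the members
  with index in \<open>s\<close>. A limit \<open>p\<close> lies in some member, with index \<open>a\<close>, say. Then \<open>x s\<close> belongs to this
  member for almost all \<open>s\<close>, although \<open>a \<in> s\<close> for almost all \<open>s\<close> because \<open>D\<close> covers \<open>\<lambda>\<close>.
\<close>

lemma limits_imp_cover_compact:
  fixes lam :: "'l rel"
  assumes lam: "Card_order lam"
    and lim: "\<And>x. x \<in> small_subsets lam \<rightarrow> topspace T \<Longrightarrow>
      \<exists>D p. ultrafilter_over (small_subsets lam) D \<and> covers_cardinal lam D \<and>
        limitin T x p (filter_of (small_subsets lam) D)"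
  shows "cover_compact lam T"
  unfolding cover_compact_def
proof (intro allI impI)
  fix \<U> assume "(\<forall>U\<in>\<U>. openin T U) \<and> topspace T \<subseteq> \<Union>\<U> \<and> |\<U>| \<le>o lam"
  then have opn: "\<And>U. U \<in> \<U> \<Longrightarrow> openin T U" and cover: "topspace T \<subseteq> \<Union>\<U>"
    and card: "|\<U>| \<le>o lam"
    by simp_all
  let ?S = "small_subsets lam"
  have "|\<U>| \<le>o |Field lam|"
    by (rule ordLeq_ordIso_trans[OF card ordIso_symmetric[OF card_of_Field_ordIso[OF lam]]])
  then obtain idx where idx: "inj_on idx \<U>" "idx ` \<U> \<subseteq> Field lam"
    by (auto simp flip: card_of_ordLeq)
  show "\<exists>\<V>. \<V> \<subseteq> \<U> \<and> topspace T \<subseteq> \<Union>\<V> \<and> |\<V>| <o lam"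
  proof (rule ccontr)
    assume "\<not> ?thesis"
    then have no: "\<not> topspace T \<subseteq> \<Union>\<V>" if "\<V> \<subseteq> \<U>" "|\<V>| <o lam" for \<V>
      using that by blast
    have "\<exists>y. y \<in> topspace T \<and> (\<forall>U\<in>\<U>. idx U \<in> s \<longrightarrow> y \<notin> U)" if s: "s \<in> ?S" for s
    proof -
      let ?\<V> = "{U \<in> \<U>. idx U \<in> s}"
      have "|?\<V>| \<le>o |s|"
        unfolding card_of_ordLeq[symmetric]
        using idx(1) by (intro exI[of _ idx]) (auto simp: inj_on_def)
      moreover have "|s| <o lam"
        using s by (simp add: small_subsets_def)
      ultimately have "|?\<V>| <o lam"
        by (rule ordLeq_ordLess_trans)
      moreover have "?\<V> \<subseteq> \<U>"
        by auto
      ultimately have "\<not> topspace T \<subseteq> \<Union>?\<V>"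
        by (intro no)
      then show ?thesis
        by auto
    qed
    then obtain x where x: "\<And>s. s \<in> ?S \<Longrightarrow> x s \<in> topspace T"
      and avoid: "\<And>s U. s \<in> ?S \<Longrightarrow> U \<in> \<U> \<Longrightarrow> idx U \<in> s \<Longrightarrow> x s \<notin> U"
      by metis
    then have "x \<in> ?S \<rightarrow> topspace T"
      by simp
    from lim[OF this] obtain D p where D: "ultrafilter_over ?S D"
      and cov: "covers_cardinal lam D" and p: "limitin T x p (filter_of ?S D)"
      by auto
    have "p \<in> topspace T"
      using p by (simp add: limitin_def)
    then obtain U where U: "U \<in> \<U>" "p \<in> U"
      using cover by auto
    have "eventually (\<lambda>s. x s \<in> U) (filter_of ?S D)"
      using p U opn by (simp add: limitin_def)
    then have "{s \<in> ?S. x s \<in> U} \<in> D"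
      by (simp add: eventually_filter_of[OF D])
    moreover have "{s \<in> ?S. idx U \<in> s} \<in> D"
      using cov U(1) idx(2) unfolding covers_cardinal_def by blast
    ultimately have "{s \<in> ?S. x s \<in> U} \<inter> {s \<in> ?S. idx U \<in> s} \<noteq> {}"
      using ultrafilter_over_Int[OF D] ultrafilter_over_nonempty[OF D] by blast
    then show False
      using avoid U(1) by blast
  qed
qed

section \<open>Convergence in a regular cardinal\<close>

lemma limitin_topology_generated_by:
  assumes p: "p \<in> \<Union>\<S>"
    and ev: "\<And>U. U \<in> \<S> \<Longrightarrow> p \<in> U \<Longrightarrow> eventually (\<lambda>i. f i \<in> U) F"
  shows "limitin (topology_generated_by \<S>) f p F"
  unfolding limitin_def
proof (intro conjI allI impI)
  show "p \<in> topspace (topology_generated_by \<S>)"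
    using p by (simp only: topology_generated_by_topspace)
next
  fix U assume "openin (topology_generated_by \<S>) U \<and> p \<in> U"
  then have "generate_topology_on \<S> U" "p \<in> U"
    by (auto dest: openin_topology_generated_by)
  then show "eventually (\<lambda>i. f i \<in> U) F"
  proof (induction U)
    case (UN K)
    then obtain V where "V \<in> K" "eventually (\<lambda>i. f i \<in> V) F"
      by blast
    then show ?case
      by (elim eventually_mono) blast
  qed (auto intro: ev eventually_conj)
qed

lemma wo_rel_of_Card_order: "Card_order r \<Longrightarrow> wo_rel r"
  using card_order_on_well_order_on by (auto simp: wo_rel_def)

lemma openin_initial_interval_imp_wo_order:
  assumes r: "Cinfinite r" and U: "openin (initial_interval_topology r) U"
  shows "openin (wo_order_topology r) U"
  using U unfolding openin_initial_interval_topology[OF r] wo_order_topology_def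
  by (auto intro!: topology_generated_by_Basis)

text \<open>
  A set witnessing non-uniformity is too small to be cofinal, so some interval \<open>[0,b]\<close> belongs to
  the image ultrafilter. If \<open>a\<close> is least with this property, then for every \<open>c < a\<close> the interval
  \<open>(c,a]\<close> belongs to it as well, and hence \<open>a\<close> is a limit.
\<close>

lemma not_uniform_imp_limit:
  assumes r: "Cinfinite r" and reg: "regularCard r"
    and D: "ultrafilter_over I D" and f: "f \<in> I \<rightarrow> Field r"
    and nonuni: "\<not> uniform_over r (image_ultrafilter I (Field r) f D)"
  obtains a where "limitin (wo_order_topology r) f a (filter_of I D)"
proof -
  have wr: "wo_rel r"
    using r by (simp add: wo_rel_of_Card_order)
  have total: "(a, b) \<in> r \<or> (b, a) \<in> r" if "a \<in> Field r" "b \<in> Field r" for a b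
    using that wo_rel.TOTALS[OF wr] by blast
  define M where "M = {b \<in> Field r. {i \<in> I. (f i, b) \<in> r} \<in> D}"
  obtain Y where Y: "Y \<subseteq> Field r" "f -` Y \<inter> I \<in> D" "\<not> |Y| =o r"
    using nonuni unfolding uniform_over_def image_ultrafilter_def by blast
  then have "\<not> cofinal Y r"
    using reg unfolding regularCard_def by blast
  then obtain b where b: "b \<in> Field r" "\<And>y. y \<in> Y \<Longrightarrow> b = y \<or> (b, y) \<notin> r"
    unfolding cofinal_def by blast
  have "(y, b) \<in> r" if "y \<in> Y" for y
    using that b total[of y b] total[of b b] Y(1) by blast
  then have "{i \<in> I. (f i, b) \<in> r} \<in> D"
    by (intro ultrafilter_over_upward[OF D Y(2)]) auto
  then have M: "M \<subseteq> Field r" "M \<noteq> {}"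
    using b(1) unfolding M_def by blast+
  define a where "a = wo_rel.minim r M"
  have a: "a \<in> M" and least: "\<And>c. c \<in> M \<Longrightarrow> (a, c) \<in> r"
    unfolding a_def using wo_rel.minim_in[OF wr M] wo_rel.minim_least[OF wr M(1)] by auto
  have aF: "a \<in> Field r" and aD: "{i \<in> I. (f i, a) \<in> r} \<in> D"
    using a unfolding M_def by auto
  have "limitin (wo_order_topology r) f a (filter_of I D)"
    unfolding wo_order_topology_def
  proof (rule limitin_topology_generated_by)
    fix U assume U: "U \<in> {Field r} \<union> {underS r c | c. c \<in> Field r} \<union> {aboveS r c | c. c \<in> Field r}"
      and aU: "a \<in> U"
    consider "U = Field r" | c where "U = underS r c" | c where "c \<in> Field r" "U = aboveS r c"
      using U by blast
    then have "{i \<in> I. f i \<in> U} \<in> D"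
    proof cases
      case 1
      then show ?thesis
        using f by (intro ultrafilter_over_upward[OF D aD]) auto
    next
      case (2 c)
      then have ac: "(a, c) \<in> r" "a \<noteq> c"
        using aU by (auto simp: underS_def)
      have "(d, c) \<in> r \<and> d \<noteq> c" if "(d, a) \<in> r" for d
        using that ac wo_rel.TRANS[OF wr] wo_rel.ANTISYM[OF wr]
        by (metis antisymD transD)
      then show ?thesis
        unfolding 2 underS_def by (intro ultrafilter_over_upward[OF D aD]) auto
    next
      case (3 c)
      then have ca: "(c, a) \<in> r" "a \<noteq> c"
        using aU by (auto simp: aboveS_def)
      then have "c \<notin> M"
        using least wo_rel.ANTISYM[OF wr] by (metis antisymD)
      then have "I - {i \<in> I. (f i, c) \<in> r} \<in> D"
        using 3 unfolding M_def by (intro ultrafilter_over_Diff[OF D]) auto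
      moreover have "(c, f i) \<in> r \<and> f i \<noteq> c" if "i \<in> I" "(f i, c) \<notin> r" for i
        using that f total[of "f i" c] total[of c c] 3(1) by auto
      ultimately show ?thesis
        unfolding 3 aboveS_def by (elim ultrafilter_over_upward[OF D]) auto
    qed
    then show "eventually (\<lambda>i. f i \<in> U) (filter_of I D)"
      by (simp add: eventually_filter_of[OF D])
  qed (use aF in auto)
  then show thesis
    by (rule that)
qed

text \<open>
  An infinite cardinal has no last element, so every point \<open>a\<close> lies in an open set \<open>[0,b)\<close>, whose
  cardinality is smaller than that of the whole space.
\<close>

lemma limit_imp_not_uniform:
  assumes r: "Cinfinite r" and D: "ultrafilter_over I D"
    and lim: "limitin (initial_interval_topology r) f a (filter_of I D)"
  shows "\<not> uniform_over r (image_ultrafilter I (Field r) f D)"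
proof -
  have a: "a \<in> Field r"
    using lim topspace_initial_interval_topology[OF r] by (auto simp: limitin_def)
  then obtain b where b: "b \<in> Field r" "a \<noteq> b" "(a, b) \<in> r"
    using infinite_Card_order_limit[of r a] r unfolding cinfinite_def by blast
  have "openin (initial_interval_topology r) (underS r b)" "a \<in> underS r b"
    using b openin_initial_interval_topology[OF r] by (auto simp: underS_def)
  then have "eventually (\<lambda>i. f i \<in> underS r b) (filter_of I D)"
    using lim by (simp add: limitin_def)
  then have "{i \<in> I. f i \<in> underS r b} \<in> D"
    by (simp add: eventually_filter_of[OF D])
  moreover have "{i \<in> I. f i \<in> underS r b} = f -` underS r b \<inter> I"
    by auto
  moreover have "underS r b \<subseteq> Field r"
    by (auto simp: underS_def Field_def)
  ultimately have "underS r b \<in> image_ultrafilter I (Field r) f D"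
    by (simp add: image_ultrafilter_def)
  moreover have "\<not> |underS r b| =o r"
    using card_of_underS[OF _ b(1)] r not_ordLess_ordIso by blast
  ultimately show ?thesis
    unfolding uniform_over_def by blast
qed

text \<open>
  Both topologies yield the same criterion, because it suffices to find a limit in the finer
  topology and to derive non-uniformity from a limit in the coarser one.
\<close>

lemma limit_iff_not_uniform:
  assumes r: "Cinfinite r" and reg: "regularCard r"
    and T: "T = wo_order_topology r \<or> T = initial_interval_topology r"
    and D: "ultrafilter_over I D" and f: "f \<in> I \<rightarrow> Field r"
  shows "(\<exists>p. limitin T f p (filter_of I D)) \<longleftrightarrow>
    \<not> uniform_over r (image_ultrafilter I (Field r) f D)"
proof -
  have finer: "limitin (initial_interval_topology r) f p F"
    if "limitin (wo_order_topology r) f p F" for p F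
    using that openin_initial_interval_imp_wo_order[OF r] topspace_wo_order_topology[of r]
      topspace_initial_interval_topology[OF r]
    unfolding limitin_def by auto
  show ?thesis
    using T finer not_uniform_imp_limit[OF r reg D f] limit_imp_not_uniform[OF r D] by metis
qed

section \<open>The characterization\<close>

theorem corollary4:
  fixes lam :: "'l rel"
    and kap :: "'k rel"
    and mu :: "'k \<Rightarrow> 'm rel"
    and X :: "'k \<Rightarrow> 'm topology"
  assumes "Cinfinite lam"
    and "Cinfinite kap"
    and "\<And>\<gamma>. \<gamma> \<in> Field kap \<Longrightarrow> Cinfinite (mu \<gamma>) \<and> regularCard (mu \<gamma>)"
    and "\<And>\<gamma>. \<gamma> \<in> Field kap \<Longrightarrow>
           X \<gamma> = wo_order_topology (mu \<gamma>) \<or> X \<gamma> = initial_interval_topology (mu \<gamma>)"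
  shows "cover_compact lam (product_topology X (Field kap)) \<longleftrightarrow> not_arrow lam kap mu"
proof -
  let ?K = "Field kap" and ?S = "small_subsets lam" and ?P = "product_topology X (Field kap)"
  have topX: "topspace (X \<gamma>) = Field (mu \<gamma>)" if "\<gamma> \<in> ?K" for \<gamma>
    using assms(3,4)[OF that] topspace_wo_order_topology topspace_initial_interval_topology
    by metis
  have coord: "(\<exists>p. limitin (X \<gamma>) g p (filter_of ?S D)) \<longleftrightarrow>
      \<not> uniform_over (mu \<gamma>) (image_ultrafilter ?S (Field (mu \<gamma>)) g D)"
    if "\<gamma> \<in> ?K" "ultrafilter_over ?S D" "g \<in> ?S \<rightarrow> Field (mu \<gamma>)" for \<gamma> g D
    using that assms(3,4)[OF that(1)] by (intro limit_iff_not_uniform) auto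
  show ?thesis
  proof
    assume comp: "cover_compact lam ?P"
    show "not_arrow lam kap mu"
      unfolding not_arrow_def
    proof (intro allI impI)
      fix f :: "'k \<Rightarrow> 'l set \<Rightarrow> 'm"
      assume f: "\<forall>\<gamma>\<in>?K. f \<gamma> \<in> ?S \<rightarrow> Field (mu \<gamma>)"
      define x where "x s = restrict (\<lambda>\<gamma>. f \<gamma> s) ?K" for s
      have "x \<in> ?S \<rightarrow> topspace ?P"
        using f topX by (fastforce simp: x_def PiE_iff)
      then obtain D p where D: "ultrafilter_over ?S D" "covers_cardinal lam D"
        and p: "limitin ?P x p (filter_of ?S D)"
        using cover_compact_imp_limit[OF assms(1) comp] by blast
      have "limitin (X \<gamma>) (f \<gamma>) (p \<gamma>) (filter_of ?S D)" if "\<gamma> \<in> ?K" for \<gamma>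
        using p that unfolding limitin_componentwise x_def by auto
      then have "\<not> (\<exists>\<gamma>\<in>?K. uniform_over (mu \<gamma>)
          (image_ultrafilter ?S (Field (mu \<gamma>)) (f \<gamma>) D))"
        using coord[OF _ D(1)] f by blast
      then show "\<exists>D. ultrafilter_over ?S D \<and> covers_cardinal lam D \<and>
          \<not> (\<exists>\<gamma>\<in>?K. uniform_over (mu \<gamma>) (image_ultrafilter ?S (Field (mu \<gamma>)) (f \<gamma>) D))"
        using D by blast
    qed
  next
    assume na: "not_arrow lam kap mu"
    show "cover_compact lam ?P"
    proof (rule limits_imp_cover_compact)
      show "Card_order lam"
        using assms(1) by simp
      fix x :: "'l set \<Rightarrow> 'k \<Rightarrow> 'm" assume x: "x \<in> ?S \<rightarrow> topspace ?P"
      have f: "\<forall>\<gamma>\<in>?K. (\<lambda>s. x s \<gamma>) \<in> ?S \<rightarrow> Field (mu \<gamma>)"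
        using x topX by (fastforce simp: PiE_iff)
      have "\<exists>D. ultrafilter_over ?S D \<and> covers_cardinal lam D \<and>
          \<not> (\<exists>\<gamma>\<in>?K. uniform_over (mu \<gamma>)
                (image_ultrafilter ?S (Field (mu \<gamma>)) (\<lambda>s. x s \<gamma>) D))"
        using spec[OF na[unfolded not_arrow_def], of "\<lambda>\<gamma> s. x s \<gamma>"] f by blast
      then obtain D where D: "ultrafilter_over ?S D" "covers_cardinal lam D"
        and nonuni: "\<And>\<gamma>. \<gamma> \<in> ?K \<Longrightarrow> \<not> uniform_over (mu \<gamma>)
          (image_ultrafilter ?S (Field (mu \<gamma>)) (\<lambda>s. x s \<gamma>) D)"
        by blast
      have "\<forall>\<gamma>\<in>?K. \<exists>q. limitin (X \<gamma>) (\<lambda>s. x s \<gamma>) q (filter_of ?S D)"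
      proof
        fix \<gamma> assume \<gamma>: "\<gamma> \<in> ?K"
        show "\<exists>q. limitin (X \<gamma>) (\<lambda>s. x s \<gamma>) q (filter_of ?S D)"
          using coord[OF \<gamma> D(1) bspec[OF f \<gamma>]] nonuni[OF \<gamma>] by simp
      qed
      then obtain p where
        p: "\<And>\<gamma>. \<gamma> \<in> ?K \<Longrightarrow> limitin (X \<gamma>) (\<lambda>s. x s \<gamma>) (p \<gamma>) (filter_of ?S D)"
        by metis
      have "{s \<in> ?S. x s \<in> topspace ?P} = ?S"
        using x by blast
      then have "eventually (\<lambda>s. x s \<in> topspace ?P) (filter_of ?S D)"
        using D(1) by (simp only: eventually_filter_of[OF D(1)]) (simp add: ultrafilter_over_def)
      then have "limitin ?P x (restrict p ?K) (filter_of ?S D)"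
        using p by (simp add: limitin_componentwise)
      then show "\<exists>D p. ultrafilter_over ?S D \<and> covers_cardinal lam D \<and>
          limitin ?P x p (filter_of ?S D)"
        using D by blast
    qed
  qed
qed

end
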